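(* Let $k,n$ be integers greater than $1$, let $k=p_1^{\alpha_1}p_2^{\alpha_2}\cdots p_r^{\alpha_r}$ be the prime factorization of $k$ (with $p_1,\dots,p_r$ distinct primes and all $\alpha_i\geq 1$), and let $$M_{k,n}:=\big\{(A,B)\in M_n(\mathbb{C})\times M_n(\mathbb{C}) \mid [A,B]^k=\mathrm{Id}_n\big\}.$$ Then $M_{k,n}$ is non-empty if and only if $n\in \mathbb{N}p_1+\mathbb{N}p_2+\cdots+\mathbb{N}p_r$.
   Context: $M_n(\mathbb{C})$ is the ring of $n\times n$ complex matrices, $[A,B]:=AB-BA$, and $\mathrm{Id}_n$ is the identity matrix. Here $\mathbb{N}$ includes $0$, so $\mathbb{N}p_1+\cdots+\mathbb{N}p_r$ is the set of all combinations $c_1p_1+\cdots+c_rp_r$ with $c_i$ non-negative integers. *)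

theory Defs
  imports
    Complex_Main
    "HOL-Computational_Algebra.Primes"
    "Jordan_Normal_Form.Matrix"
begin

definition commutator :: "'a :: ring mat \<Rightarrow> 'a mat \<Rightarrow> 'a mat" where
  "commutator A B = A * B - B * A"

definition M_set :: "nat \<Rightarrow> nat \<Rightarrow> (complex mat \<times> complex mat) set" where
  "M_set k n = {(A, B). A \<in> carrier_mat n n \<and> B \<in> carrier_mat n n \<and>
     commutator A B ^\<^sub>m k = 1\<^sub>m n}"

text \<open>The set \<open>\<nat> p\<^sub>1 + \<dots> + \<nat> p\<^sub>r\<close>; here \<open>\<nat>\<close> contains 0.\<close>

definition nat_combinations :: "nat \<Rightarrow> (nat \<Rightarrow> nat) \<Rightarrow> nat set" where
  "nat_combinations r p = {\<Sum>i=1..r. c i * p i | c :: nat \<Rightarrow> nat. True}"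

end

theory Submission
  imports
    Defs
    "Jordan_Normal_Form.Schur_Decomposition"
    "HOL-Number_Theory.Cong"
    "HOL-Computational_Algebra.Squarefree"
begin

text \<open>If \<open>[A, B] ^ k = 1\<close>, the eigenvalues of \<open>[A, B]\<close> are \<open>n\<close> \<open>k\<close>-th roots of unity with sum zero, because
  a commutator has trace zero; conversely every diagonal matrix of trace zero is a commutator. So
  the claim is the theorem of Lam and Leung on the number of terms of a vanishing sum of \<open>k\<close>-th roots
  of unity.

  If the square of a prime \<open>q\<close> divides \<open>m = q * l\<close>, a vanishing sum of \<open>m\<close>-th roots of unity splits
  into vanishing sums over the fibres of \<open>z \<mapsto> z ^ l\<close>, which are rotated sums of \<open>l\<close>-th roots of unity.
  If \<open>m\<close> is squarefree and not prime, let \<open>p1 < q\<close> be its two smallest primes. The suitably rotated fibres are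
  \<open>q\<close> multisets of \<open>l\<close>-th roots of unity with the same sum. Let \<open>b\<close> be the smallest size among them.
  If this smallest one is contained in all others, the differences vanish and induction applies.
  Otherwise one fibre has at least \<open>(p1 - b) * (q - 1)\<close> elements, so there are at least
  \<open>p1 * (q - 1)\<close> terms altogether, and every such number is a combination of \<open>p1\<close> and \<open>q\<close>.
  The fibre sums are compared by means of the Galois conjugations \<open>z \<mapsto> z ^ (1 + l * t)\<close>.\<close>

section \<open>Conjugates of roots of unity\<close>

abbreviation ipoly :: "int poly \<Rightarrow> complex \<Rightarrow> complex" where
  "ipoly P z \<equiv> poly (of_int_poly P) z"

text \<open>Plays the role of the minimal polynomial, with divisibility over the integers: an
  annihilator of least degree is made primitive, pseudo-division gives
  \<open>smult a P = f * q\<close>, and by Gauss's lemma \<open>a\<close> divides the content of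
  \<open>q\<close> and cancels.\<close>

lemma primitive_annihilator:
  assumes "P0 \<noteq> 0" "ipoly P0 z = 0"
  obtains f where "f \<noteq> 0" "ipoly f z = 0" "\<And>P. ipoly P z = 0 \<Longrightarrow> f dvd P"
proof -
  obtain g where g: "g \<noteq> 0" "ipoly g z = 0"
    and min: "\<And>P. P \<noteq> 0 \<Longrightarrow> ipoly P z = 0 \<Longrightarrow> degree g \<le> degree P"
    using arg_min_nat_lemma[of "\<lambda>P. P \<noteq> 0 \<and> ipoly P z = 0" P0 degree] assms by blast
  define f where "f = primitive_part g"
  have g_eq: "g = smult (content g) f" by (simp add: f_def)
  have "of_int (content g) * ipoly f z = 0"
    using g(2) by (subst (asm) g_eq) (simp add: hom_distribs)
  hence f0: "f \<noteq> 0" "ipoly f z = 0" using g(1) by (auto simp: f_def)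
  have deg: "degree f = degree g" using g(1) by (simp add: f_def)
  have cont: "content f = 1" using g(1) by (simp add: f_def)
  have "f dvd P" if P: "ipoly P z = 0" for P
  proof -
    obtain a q where aq: "a \<noteq> 0" "smult a P = f * q + pseudo_mod P f"
      using pseudo_mod(1)[OF f0(1)] by blast
    have "ipoly (pseudo_mod P f) z = ipoly (smult a P - f * q) z" using aq(2) by simp
    also have "\<dots> = 0" using P f0 by (simp add: hom_distribs)
    finally have "ipoly (pseudo_mod P f) z = 0" .
    hence "pseudo_mod P f = 0 \<or> degree f \<le> degree (pseudo_mod P f)"
      using min[of "pseudo_mod P f"] deg by auto
    hence "pseudo_mod P f = 0" using pseudo_mod(2)[OF f0(1), of P] by linarith
    hence eq: "smult a P = f * q" using aq(2) by simp
    hence "content (smult a P) = content q" using cont by (simp add: content_mult)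
    hence "content q = normalize a * content P" by simp
    hence "a dvd content q" by (metis dvd_mult2 dvd_normalize_iff dvd_refl)
    hence "[:a:] dvd q" by (simp add: const_poly_dvd_iff_dvd_content)
    then obtain q' where "q = [:a:] * q'" by blast
    hence "smult a P = smult a (f * q')" using eq by simp
    hence "smult a (P - f * q') = 0" by (simp add: smult_diff_right)
    hence "P = f * q'" using aq(1) by (simp only: smult_eq_0_iff) simp
    thus ?thesis by simp
  qed
  thus ?thesis using that f0 by blast
qed

section \<open>Frobenius congruences modulo a prime\<close>

lemma prime_dvd_binomial_power:
  fixes x y :: "'a :: comm_ring_1"
  assumes "prime p"
  shows "of_nat p dvd (x + y) ^ p - x ^ p - y ^ p"
proof -
  have p: "p > 0" using assms prime_gt_0_nat by blast
  have "(x + y) ^ p = (\<Sum>k\<le>p. of_nat (p choose k) * x ^ k * y ^ (p - k))"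
    by (simp add: binomial_ring)
  also have "{..p} = insert 0 (insert p {0<..<p})" using p by auto
  also have "(\<Sum>k\<in>\<dots>. of_nat (p choose k) * x ^ k * y ^ (p - k)) =
      y ^ p + (x ^ p + (\<Sum>k\<in>{0<..<p}. of_nat (p choose k) * x ^ k * y ^ (p - k)))"
    using p by simp
  finally have "(x + y) ^ p - x ^ p - y ^ p =
      (\<Sum>k\<in>{0<..<p}. of_nat (p choose k) * x ^ k * y ^ (p - k))" by simp
  also have "of_nat p dvd \<dots>"
  proof (rule dvd_sum)
    fix k assume "k \<in> {0<..<p}"
    hence "p dvd (p choose k)" using assms by (intro dvd_choose_prime) auto
    hence "(of_nat p :: 'a) dvd of_nat (p choose k)" by (metis of_nat_mult dvd_def)
    thus "of_nat p dvd (of_nat (p choose k) :: 'a) * x ^ k * y ^ (p - k)"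
      by (simp add: dvd_mult2)
  qed
  finally show ?thesis .
qed

text \<open>Fermat's little theorem. The congruences at \<open>x\<close> and \<open>x + 1\<close>
  are equivalent, so the induction runs both upwards and downwards from 0.\<close>

lemma prime_dvd_int_power_self:
  fixes a :: int
  assumes "prime p"
  shows "int p dvd a ^ p - a"
proof -
  have step: "int p dvd (x + 1) ^ p - (x + 1) \<longleftrightarrow> int p dvd x ^ p - x" for x :: int
  proof -
    have "int p dvd (x + 1) ^ p - x ^ p - 1 ^ p"
      using prime_dvd_binomial_power[OF assms, of x 1] by simp
    moreover have "(x + 1) ^ p - (x + 1) = ((x + 1) ^ p - x ^ p - 1 ^ p) + (x ^ p - x)" by simp
    ultimately show ?thesis by (metis dvd_add_right_iff)
  qed
  show ?thesis
  proof (induction a rule: int_induct[where k = 0])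
    case base
    then show ?case using prime_gt_0_nat[OF assms] by (simp add: power_0_left)
  next
    case (step1 i)
    then show ?case by (simp only: step)
  next
    case (step2 i)
    then show ?case using step[of "i - 1"] by simp
  qed
qed

text \<open>Induction on the coefficients: with \<open>pCons a g\<close> written as a + X * g, the
  binomial congruence separates the summands and Fermat's theorem handles the constant.\<close>

lemma prime_dvd_pcompose_monom:
  fixes g :: "int poly"
  assumes "prime p"
  shows "of_nat p dvd pcompose g (monom 1 p) - g ^ p"
proof (induction g)
  case 0
  then show ?case using prime_gt_0_nat[OF assms] by (simp add: power_0_left)
next
  case (pCons a g)
  define X :: "int poly" where "X = monom 1 1"
  have X: "monom 1 p = X ^ p" by (simp add: X_def monom_power)
  have eq: "pCons a g = [:a:] + X * g" by (simp add: X_def monom_altdef)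
  have 1: "of_nat p dvd ([:a:] + X * g) ^ p - [:a:] ^ p - (X * g) ^ p"
    by (rule prime_dvd_binomial_power[OF assms])
  have 2: "of_nat p dvd [:a:] ^ p - [:a:]"
  proof -
    obtain c where "a ^ p - a = int p * c" using prime_dvd_int_power_self[OF assms] by blast
    hence "[:a:] ^ p - [:a:] = of_nat p * [:c:]"
      by (simp add: poly_const_pow of_nat_poly)
    thus ?thesis by (metis dvd_triv_left)
  qed
  have 3: "of_nat p dvd X ^ p * (pcompose g (monom 1 p) - g ^ p)"
    using pCons.IH by simp
  have decomp: "pcompose (pCons a g) (monom 1 p) - pCons a g ^ p =
    X ^ p * (pcompose g (monom 1 p) - g ^ p) - (([:a:] + X * g) ^ p - [:a:] ^ p - (X * g) ^ p)
      - ([:a:] ^ p - [:a:])"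
    unfolding pcompose_pCons by (subst eq) (simp add: X algebra_simps)
  show ?case unfolding decomp by (rule dvd_diff[OF dvd_diff[OF 3 1] 2])
qed

text \<open>Let \<open>f\<close> be the minimal polynomial of \<open>z\<close>, \<open>x ^ n - 1 = f * g\<close>, and suppose \<open>g\<close> vanishes at \<open>z ^ p\<close>.
  Then \<open>p\<close> divides \<open>g(z) ^ p\<close> in \<open>\<int>[z]\<close>, and differentiating gives \<open>n = z * f'(z) * g(z)\<close>, so that
  \<open>p\<close> divides \<open>n ^ p\<close> in \<open>\<int>[z]\<close>, hence in \<open>\<int>\<close>.\<close>

lemma root_of_unity_conj_prime:
  assumes n: "n > 0" and z: "z ^ n = 1" and p: "prime p" "\<not> p dvd n" and P: "ipoly P z = 0"
  shows "ipoly P (z ^ p) = 0"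
proof -
  let ?U = "monom 1 n - 1 :: int poly"
  have U_eval: "ipoly ?U w = w ^ n - 1" for w by (simp add: hom_distribs poly_monom)
  have U0: "?U \<noteq> 0"
  proof
    assume "?U = 0"
    hence "coeff ?U n = 0" by simp
    thus False using n by (simp add: coeff_1)
  qed
  obtain f where f: "f \<noteq> 0" "ipoly f z = 0" "\<And>P. ipoly P z = 0 \<Longrightarrow> f dvd P"
    using primitive_annihilator[OF U0, of z] U_eval z by auto
  obtain g where g: "?U = f * g" using f(3)[of ?U] U_eval z by auto
  \<comment> \<open>As \<open>f\<close> divides a monic polynomial, its leading coefficient is a
    unit; pseudo-division by \<open>f\<close> will only introduce a unit factor.\<close>
  have lead: "lead_coeff f dvd 1"
  proof -
    have "degree ?U = n"
      using degree_add_eq_left[of "- 1 :: int poly" "monom 1 n"] n by (simp add: degree_monom_eq)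
    hence "lead_coeff ?U = 1" using n by (simp add: coeff_1)
    thus ?thesis using g by (metis lead_coeff_mult dvd_triv_left)
  qed
  obtain Q where Q: "P = f * Q" using f(3)[OF P] by blast
  have "ipoly f (z ^ p) = 0"
  proof (rule ccontr)
    assume nz: "ipoly f (z ^ p) \<noteq> 0"
    have "(z ^ p) ^ n = 1" using z by (metis power_mult mult.commute power_one)
    hence "ipoly ?U (z ^ p) = 0" by (simp add: U_eval)
    hence gz: "ipoly g (z ^ p) = 0" using nz unfolding g by (simp add: hom_distribs)
    obtain h where h: "pcompose g (monom 1 p) - g ^ p = of_nat p * h"
      using prime_dvd_pcompose_monom[OF p(1)] by blast
    have "ipoly (pcompose g (monom 1 p)) z = ipoly g (z ^ p)"
    proof (induction g)
      case (pCons a g)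
      have "ipoly (pcompose (pCons a g) (monom 1 p)) z =
          ipoly [:a:] z + ipoly (monom 1 p) z * ipoly (pcompose g (monom 1 p)) z"
        unfolding pcompose_pCons by (simp only: of_int_poly_hom.hom_add of_int_poly_hom.hom_mult poly_add poly_mult)
      moreover have "ipoly (pCons a g) (z ^ p) = ipoly [:a:] z + z ^ p * ipoly g (z ^ p)"
        by (simp add: hom_distribs)
      moreover have "ipoly (monom 1 p) z = z ^ p" by (simp add: poly_monom)
      ultimately show ?case by (simp only: pCons.IH)
    qed simp
    hence gp: "ipoly (g ^ p) z = - ipoly (of_nat p * h) z" using gz unfolding h[symmetric] 
      by (simp add: hom_distribs)
    let ?E = "monom 1 1 * pderiv f"
    have "pderiv ?U = pderiv f * g + f * pderiv g" by (simp add: g pderiv_mult algebra_simps)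
    hence "ipoly (monom 1 1 * pderiv ?U) z = ipoly ?E z * ipoly g z"
      using f(2) by (simp add: hom_distribs algebra_simps)
    moreover have "monom 1 1 * pderiv ?U = monom (int n) n"
      using n by (simp add: pderiv_diff pderiv_monom mult_monom)
    hence "ipoly (monom 1 1 * pderiv ?U) z = of_nat n" by (simp add: z poly_monom hom_distribs)
    ultimately have "of_nat n = ipoly ?E z * ipoly g z" by simp
    hence "of_nat n ^ p = ipoly ?E z ^ p * ipoly (g ^ p) z" 
      by (simp add: hom_distribs power_mult_distrib)
    hence "ipoly ([:int n ^ p:] + of_nat p * (?E ^ p * h)) z = 0"
      unfolding gp by (simp add: hom_distribs algebra_simps)
    hence fd: "f dvd [:int n ^ p:] + of_nat p * (?E ^ p * h)" by (rule f(3))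
    \<comment> \<open>Reduction modulo \<open>f\<close> brings the multiple of \<open>p\<close>
      below the degree of \<open>f\<close>. The result is divisible by \<open>f\<close>, hence zero,
      and its constant coefficient shows that \<open>p\<close> divides a unit times n^p.\<close>
    obtain q r where qr: "pseudo_divmod (?E ^ p * h) f = (q, r)" by force
    let ?c = "lead_coeff f ^ (Suc (degree (?E ^ p * h)) - degree f)"
    note pd = pseudo_divmod[OF f(1) qr]
    have c: "?c dvd 1" using lead by (metis dvd_power_same power_one)
    have "f dvd smult ?c ([:int n ^ p:] + of_nat p * (?E ^ p * h))" using fd by (rule dvd_smult)
    also have "smult ?c ([:int n ^ p:] + of_nat p * (?E ^ p * h)) = 
        [:?c * int n ^ p:] + of_nat p * (smult ?c (?E ^ p * h))"
      by (simp add: smult_add_right)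
    also have "\<dots> = f * (of_nat p * q) + ([:?c * int n ^ p:] + of_nat p * r)"
      unfolding pd(1) by (simp add: algebra_simps)
    finally have fd': "f dvd [:?c * int n ^ p:] + of_nat p * r"
      by (simp add: dvd_add_right_iff)
    have deg_f: "degree f > 0"
    proof (rule ccontr)
      assume "\<not> degree f > 0"
      then obtain a where "f = [:a:]" using degree_eq_zeroE by auto
      thus False using f(1,2) by simp
    qed
    have "degree ([:?c * int n ^ p:] + of_nat p * r) < degree f"
    proof (rule degree_add_less)
      show "degree [:?c * int n ^ p:] < degree f" using deg_f by simp
      have "degree (of_nat p * r) = degree r" using p(1)
        by (cases "r = 0") (auto simp: degree_mult_eq of_nat_poly)
      thus "degree (of_nat p * r) < degree f" using pd(2) deg_f by auto
    qed
    hence "[:?c * int n ^ p:] + of_nat p * r = 0" using dvd_imp_degree_le[OF fd'] by linarith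
    hence "coeff ([:?c * int n ^ p:] + of_nat p * r) 0 = 0" by (simp only: coeff_0)
    hence "?c * int n ^ p = int p * (- coeff r 0)" by (simp add: of_nat_poly)
    hence "int p dvd ?c * int n ^ p" by (rule dvdI)
    moreover have "coprime (int p) ?c" by (rule is_unit_right_imp_coprime[OF c])
    ultimately have "int p dvd int n ^ p" by (simp only: coprime_dvd_mult_right_iff)
    hence "p dvd n ^ p" by (simp only: of_nat_dvd_iff flip: of_nat_power)
    hence "p dvd n" by (rule prime_dvd_power[OF p(1)])
    thus False using p(2) by simp
  qed
  thus ?thesis by (simp add: Q hom_distribs)
qed

text \<open>The prime factors of \<open>k\<close> are applied one after another; each intermediate
  power of \<open>z\<close> is again an n-th root of unity, so the prime case applies to it.\<close>

lemma root_of_unity_conj: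
  assumes "n > 0" "z ^ n = 1" "k > 0" "coprime k n" "ipoly P z = 0"
  shows "ipoly P (z ^ k) = 0"
  using assms(3-)
proof (induction k rule: prime_divisors_induct)
  case (factor p k)
  have "\<not> p dvd n" using factor
    by (metis coprime_mult_left_iff coprime_absorb_left not_prime_unit)
  moreover have "(z ^ k) ^ n = 1" using assms(2) by (metis power_mult mult.commute power_one)
  ultimately have "ipoly P ((z ^ k) ^ p) = 0"
    using factor assms(1) by (intro root_of_unity_conj_prime[of n "z ^ k" p P]) auto
  thus ?case by (metis power_mult mult.commute)
qed auto

lemma root_of_unity_obtain:
  assumes "m > 0"
  obtains w :: complex where "w ^ m = 1" "\<And>z. z ^ m = 1 \<Longrightarrow> \<exists>j. z = w ^ j"
proof
  let ?w = "cis (2 * pi / real m)"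
  show "?w ^ m = 1" using assms by (simp add: DeMoivre)
  fix z :: complex assume "z ^ m = 1"
  hence "z \<in> (\<lambda>k. cis (2 * pi * real k / real m)) ` {..<m}"
    using bij_betw_roots_unity[OF assms] by (auto simp: bij_betw_def)
  then obtain k where "z = cis (2 * pi * real k / real m)" by blast
  hence "z = ?w ^ k" by (simp add: DeMoivre mult.commute)
  thus "\<exists>j. z = ?w ^ j" ..
qed

text \<open>Each multiset is encoded by an integer polynomial in a generator \<open>w\<close>, which
  yields all power sums at once. Equal sums mean that the difference of the two polynomials vanishes
  at \<open>w\<close>, hence at its conjugate w^k.\<close>

lemma roots_of_unity_sum_conj:
  fixes X Y :: "complex multiset"
  assumes m: "m > 0" and X: "\<And>z. z \<in># X \<Longrightarrow> z ^ m = 1" and Y: "\<And>z. z \<in># Y \<Longrightarrow> z ^ m = 1"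
    and eq: "sum_mset X = sum_mset Y" and k: "k > 0" "coprime k m"
  shows "(\<Sum>z\<in>#X. z ^ k) = (\<Sum>z\<in>#Y. z ^ k)"
proof -
  obtain w :: complex where w: "w ^ m = 1" "\<And>z. z ^ m = 1 \<Longrightarrow> \<exists>j. z = w ^ j"
    using root_of_unity_obtain[OF m] by blast
  have rep: "\<exists>P. \<forall>l. ipoly P (w ^ l) = (\<Sum>z\<in>#Z. z ^ l)" if "\<And>z. z \<in># Z \<Longrightarrow> z ^ m = 1" for Z
    using that
  proof (induction Z)
    case empty
    show ?case by (intro exI[of _ 0]) simp
  next
    case (add z Z)
    then obtain P where P: "\<forall>l. ipoly P (w ^ l) = (\<Sum>z\<in>#Z. z ^ l)" by auto
    obtain j where "z = w ^ j" using w(2) add.prems by auto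
    thus ?case using P by (intro exI[of _ "monom 1 j + P"])
      (auto simp: hom_distribs poly_monom mult.commute simp flip: power_mult)
  qed
  obtain P where P: "\<And>l. ipoly P (w ^ l) = (\<Sum>z\<in>#X. z ^ l)" using rep[of X] X by auto
  obtain Q where Q: "\<And>l. ipoly Q (w ^ l) = (\<Sum>z\<in>#Y. z ^ l)" using rep[of Y] Y by auto
  have "ipoly (P - Q) w = 0" using P[of 1] Q[of 1] eq by (simp add: hom_distribs)
  hence "ipoly (P - Q) (w ^ k) = 0" using root_of_unity_conj m w(1) k by blast
  thus ?thesis using P[of k] Q[of k] by (simp add: hom_distribs)
qed

section \<open>Fibres of the power map\<close>

definition unity_mset :: "nat \<Rightarrow> complex multiset \<Rightarrow> bool" where
  "unity_mset m X \<longleftrightarrow> (\<forall>z\<in>#X. z ^ m = 1)"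

definition fibre :: "nat \<Rightarrow> complex \<Rightarrow> complex multiset \<Rightarrow> complex multiset" where
  "fibre l c X = {#z \<in># X. z ^ l = c#}"

text \<open>Each term \<open>z\<close> lies in the fibre over z^l only, and z^l is a q-th root of
  unity. The general monoid covers both sums and, with \<open>g\<close> constantly 1,
  cardinalities.\<close>

lemma sum_mset_fibres:
  fixes g :: "complex \<Rightarrow> 'b :: comm_monoid_add"
  assumes "q > 0" "unity_mset (q * l) X"
  shows "(\<Sum>z\<in>#X. g z) = (\<Sum>c | c ^ q = 1. \<Sum>z\<in>#fibre l c X. g z)"
  using assms(2)
proof (induction X)
  case (add z X)
  have fin: "finite {c :: complex. c ^ q = 1}" using assms(1) by (intro finite_roots_unity) simp
  have "z ^ (q * l) = 1" using add.prems by (simp add: unity_mset_def)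
  hence "(z ^ l) ^ q = 1" by (simp add: power_mult[symmetric] mult.commute)
  hence "(\<Sum>c | c ^ q = 1. if z ^ l = c then g z else 0) = g z"
    using fin by (simp add: sum.delta)
  moreover have "(\<Sum>w\<in>#fibre l c (add_mset z X). g w) =
      (if z ^ l = c then g z else 0) + (\<Sum>w\<in>#fibre l c X. g w)" for c
    by (simp add: fibre_def)
  moreover have "unity_mset (q * l) X" using add.prems by (simp add: unity_mset_def)
  ultimately show ?case using add.IH by (simp add: sum.distrib)
qed (simp add: fibre_def)

lemma size_fibres:
  assumes "q > 0" "unity_mset (q * l) X"
  shows "size X = (\<Sum>c | c ^ q = 1. size (fibre l c X))"
  using sum_mset_fibres[OF assms, of "\<lambda>_. 1 :: nat"] by simp

text \<open>The conjugation with exponent \<open>1 + l * t\<close> multiplies the fibre over \<open>c\<close> by \<open>c ^ t\<close>.\<close>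

lemma fibre_moments_eq:
  assumes "q > 0" "l > 0" "unity_mset (q * l) X" "unity_mset (q * l) Y" "sum_mset X = sum_mset Y"
    and "coprime (1 + l * t) (q * l)"
  shows "(\<Sum>c | c ^ q = 1. c ^ t * sum_mset (fibre l c X)) =
    (\<Sum>c | c ^ q = 1. c ^ t * sum_mset (fibre l c Y))"
proof -
  have moment: "(\<Sum>z\<in>#Z. z ^ (1 + l * t)) = (\<Sum>c | c ^ q = 1. c ^ t * sum_mset (fibre l c Z))"
    if "unity_mset (q * l) Z" for Z
  proof -
    have fib: "(\<Sum>z\<in>#fibre l c Z. z ^ (1 + l * t)) = c ^ t * sum_mset (fibre l c Z)" for c
    proof -
      have "(\<Sum>z\<in>#fibre l c Z. z ^ (1 + l * t)) = (\<Sum>z\<in>#fibre l c Z. c ^ t * z)"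
        by (intro arg_cong[where f = sum_mset] image_mset_cong)
           (auto simp: fibre_def power_add power_mult)
      thus ?thesis by (simp add: sum_mset_distrib_left)
    qed
    show ?thesis unfolding sum_mset_fibres[OF assms(1) that] by (simp only: fib)
  qed
  have "(\<Sum>z\<in>#X. z ^ (1 + l * t)) = (\<Sum>z\<in>#Y. z ^ (1 + l * t))"
    using assms by (intro roots_of_unity_sum_conj[of "q * l"]) (auto simp: unity_mset_def)
  thus ?thesis unfolding moment[OF assms(3)] moment[OF assms(4)] .
qed

text \<open>Inversion of the finite Fourier transform on the group of q-th roots of unity: the
  powers (c / a)^t sum to \<open>q\<close> if c = a and to 0 otherwise.\<close>

lemma roots_of_unity_fourier_inversion:
  fixes E :: "complex \<Rightarrow> complex"
  assumes "q > 0" "a ^ q = 1"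
  shows "of_nat q * E a = (\<Sum>t<q. inverse a ^ t * (\<Sum>c | c ^ q = 1. c ^ t * E c))"
proof -
  have fin: "finite {c :: complex. c ^ q = 1}" using assms(1) by (intro finite_roots_unity) simp
  have a0: "a \<noteq> 0" using assms by (auto simp: power_0_left)
  have geo: "(\<Sum>t<q. (c / a) ^ t) = (if c = a then of_nat q else 0)" if "c ^ q = 1" for c
  proof (cases "c = a")
    case False
    hence "c / a \<noteq> 1" using a0 by simp
    hence "(\<Sum>t<q. (c / a) ^ t) = ((c / a) ^ q - 1) / (c / a - 1)" by (rule geometric_sum)
    thus ?thesis using that assms(2) False by (simp add: power_divide)
  qed (use a0 in simp)
  have "(\<Sum>t<q. inverse a ^ t * (\<Sum>c | c ^ q = 1. c ^ t * E c)) =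
    (\<Sum>t<q. \<Sum>c | c ^ q = 1. (c / a) ^ t * E c)"
    by (simp add: sum_distrib_left divide_inverse power_mult_distrib mult_ac)
  also have "\<dots> = (\<Sum>c | c ^ q = 1. (\<Sum>t<q. (c / a) ^ t) * E c)"
    by (subst sum.swap) (simp add: sum_distrib_right)
  also have "\<dots> = (\<Sum>c | c ^ q = 1. if c = a then of_nat q * E c else 0)"
    by (intro sum.cong) (auto simp: geo)
  also have "\<dots> = of_nat q * E a" using fin assms(2) by simp
  finally show ?thesis by simp
qed

lemma coprime_one_plus_mult: "coprime (1 + l * t) (l :: nat)"
  by (rule coprimeI) (metis dvd_add_left_iff dvd_mult2)

text \<open>When \<open>q\<close> divides \<open>l\<close>, every exponent 1 + l * t is coprime to q
  * l. So all moments of the differences vanish, and Fourier inversion makes each difference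
  zero.\<close>

lemma fibre_sums_eq:
  assumes "prime q" "q dvd l" "l > 0" "unity_mset (q * l) X" "unity_mset (q * l) Y"
    and "sum_mset X = sum_mset Y" "c ^ q = 1"
  shows "sum_mset (fibre l c X) = sum_mset (fibre l c Y)"
proof -
  let ?E = "\<lambda>c. sum_mset (fibre l c X) - sum_mset (fibre l c Y)"
  have q: "q > 0" using assms(1) prime_gt_0_nat by blast
  have "coprime (1 + l * t) (q * l)" for t
  proof -
    have "coprime (1 + l * t) q"
      by (rule coprime_divisors[OF dvd_refl assms(2) coprime_one_plus_mult])
    thus ?thesis using coprime_one_plus_mult[of l t] by simp
  qed
  hence "(\<Sum>c | c ^ q = 1. c ^ t * ?E c) = 0" for t
    using fibre_moments_eq[OF q assms(3-6)] by (simp add: right_diff_distrib sum_subtractf)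
  hence "of_nat q * ?E c = 0"
    using roots_of_unity_fourier_inversion[OF q assms(7), of ?E] by simp
  thus ?thesis using q by simp
qed

text \<open>The exponent \<open>s\<close> is chosen with \<open>q dvd 1 + l * s\<close>: then \<open>c ^ s * z\<close> is an \<open>l\<close>-th root of unity
  whenever \<open>z ^ l = c\<close> and \<open>c ^ q = 1\<close>.\<close>

definition rotated_fibre :: "nat \<Rightarrow> nat \<Rightarrow> complex \<Rightarrow> complex multiset \<Rightarrow> complex multiset" where
  "rotated_fibre l s c X = image_mset ((*) (c ^ s)) (fibre l c X)"

lemma rotation_exponent_exists:
  fixes q l :: nat
  assumes "prime q" "\<not> q dvd l"
  obtains s where "s < q" "q dvd 1 + l * s"
proof -
  have q0: "q > 0" using assms(1) prime_gt_0_nat by blast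
  have "coprime l q" using prime_imp_coprime[OF assms] by (simp add: coprime_commute)
  then obtain x where "[l * x = 1] (mod q)" using cong_solve_coprime_nat by auto
  \<comment> \<open>Here q - 1 stands for -1, so that l * y = -1 is solved modulo
    \<open>q\<close>.\<close>
  hence "[l * x * (q - 1) = 1 * (q - 1)] (mod q)" by (intro cong_mult cong_refl)
  then obtain y where y: "[l * y = q - 1] (mod q)" by (auto simp: mult.assoc)
  have "[1 + l * (y mod q) = 1 + (q - 1)] (mod q)"
    by (intro cong_add cong_refl) (use y in \<open>simp add: cong_def mod_mult_right_eq\<close>)
  hence "q dvd 1 + l * (y mod q)" using q0 by (simp add: cong_def dvd_eq_mod_eq_0)
  thus ?thesis using that[of "y mod q"] q0 by simp
qed

lemma rotated_fibre_empty [simp]: "rotated_fibre l s c {#} = {#}"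
  by (simp add: rotated_fibre_def fibre_def)

lemma sum_mset_rotated_fibre:
  "sum_mset (rotated_fibre l s c X) = c ^ s * sum_mset (fibre l c X)"
  by (simp add: rotated_fibre_def sum_mset_distrib_left)

text \<open>Among the exponents t < q only \<open>s\<close> makes 1 + l * t divisible by
  \<open>q\<close>. All other moments of the differences vanish, so Fourier inversion leaves the
  difference over \<open>c\<close> proportional to c^(-s), and rotation by c^s removes this
  dependence.\<close>

lemma rotated_fibre_sums_const:
  assumes "prime q" "\<not> q dvd l" "q dvd 1 + l * s" "s < q"
    and "unity_mset (q * l) X" "unity_mset (q * l) Y" "sum_mset X = sum_mset Y"
  shows "\<exists>K. \<forall>c. c ^ q = 1 \<longrightarrow>
    sum_mset (rotated_fibre l s c Y) = sum_mset (rotated_fibre l s c X) + K"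
proof -
  let ?E = "\<lambda>c. sum_mset (fibre l c Y) - sum_mset (fibre l c X)"
  have q: "q > 0" using assms(1) prime_gt_0_nat by blast
  have l: "l > 0" using assms(2) by (cases l) auto
  define K where "K = (\<Sum>c | c ^ q = 1. c ^ s * ?E c)"
  have zero: "(\<Sum>c | c ^ q = 1. c ^ t * ?E c) = 0" if "t < q" "t \<noteq> s" for t
  proof -
    have "\<not> q dvd 1 + l * t"
    proof
      assume "q dvd 1 + l * t"
      hence "int q dvd int (1 + l * t)" "int q dvd int (1 + l * s)"
        using assms(3) by (simp_all only: of_nat_dvd_iff)
      hence "int q dvd int (1 + l * t) - int (1 + l * s)" by (rule dvd_diff)
      hence "int q dvd int l * (int t - int s)" by (simp add: algebra_simps)
      moreover have "coprime (int q) (int l)"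
        using assms(1,2) by (simp add: prime_imp_coprime)
      ultimately have "int q dvd int t - int s" by (simp add: coprime_dvd_mult_right_iff)
      thus False using dvd_imp_le_int[of "int t - int s" "int q"] that assms(4) by auto
    qed
    hence "coprime q (1 + l * t)" by (rule prime_imp_coprime[OF assms(1)])
    hence "coprime (1 + l * t) (q * l)"
      using coprime_one_plus_mult[of l t] by (simp add: coprime_commute)
    thus ?thesis
      using fibre_moments_eq[OF q l assms(5-7)] by (simp add: right_diff_distrib sum_subtractf)
  qed
  have shift: "c ^ s * ?E c = K / of_nat q" if c: "c ^ q = 1" for c
  proof -
    have c0: "c \<noteq> 0" using c q by (auto simp: power_0_left)
    have "of_nat q * ?E c = (\<Sum>t<q. inverse c ^ t * (\<Sum>c | c ^ q = 1. c ^ t * ?E c))"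
      by (rule roots_of_unity_fourier_inversion[OF q c])
    also have "\<dots> = (\<Sum>t<q. if t = s then inverse c ^ s * K else 0)"
      by (intro sum.cong) (auto simp: zero K_def)
    also have "\<dots> = inverse c ^ s * K" using assms(4) by simp
    finally have "of_nat q * ?E c = inverse c ^ s * K" .
    moreover have "c ^ s * e = K / of_nat q" if "of_nat q * e = inverse c ^ s * K" for e
      using that c0 q by (simp add: field_simps)
    ultimately show ?thesis by blast
  qed
  show ?thesis
    unfolding sum_mset_rotated_fibre
  proof (intro exI[of _ "K / of_nat q"] allI impI)
    fix c :: complex assume "c ^ q = 1"
    from shift[OF this] show "c ^ s * sum_mset (fibre l c Y) = c ^ s * sum_mset (fibre l c X) + K / of_nat q"
      by (simp only: right_diff_distrib diff_eq_eq add.commute)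
  qed
qed

lemma unity_mset_rotated_fibre:
  assumes "q dvd 1 + l * s" "c ^ q = 1"
  shows "unity_mset l (rotated_fibre l s c X)"
proof -
  obtain k where k: "1 + l * s = q * k" using assms(1) by blast
  have "(c ^ s * z) ^ l = 1" if "z ^ l = c" for z
  proof -
    have "(c ^ s * z) ^ l = c ^ (s * l) * z ^ l"
      by (simp only: power_mult_distrib power_mult)
    also have "\<dots> = c ^ (1 + l * s)" by (simp only: that power_add) (simp add: mult.commute)
    also have "\<dots> = 1" unfolding k power_mult assms(2) by simp
    finally show ?thesis .
  qed
  thus ?thesis by (auto simp: unity_mset_def rotated_fibre_def fibre_def)
qed

lemma size_rotated_fibres:
  assumes "q > 0" "unity_mset (q * l) X"
  shows "size X = (\<Sum>c | c ^ q = 1. size (rotated_fibre l s c X))"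
  using size_fibres[OF assms] by (simp add: rotated_fibre_def)

lemma subset_mset_rotated_fibres:
  assumes "q > 0" "unity_mset (q * l) X"
    and sub: "\<And>c. c ^ q = 1 \<Longrightarrow> rotated_fibre l s c X \<subseteq># rotated_fibre l s c Y"
  shows "X \<subseteq># Y"
proof (rule mset_subset_eqI)
  fix z
  show "count X z \<le> count Y z"
  proof (cases "z \<in># X")
    case True
    define c where "c = z ^ l"
    have "z ^ (q * l) = 1" using assms(2) True by (simp add: unity_mset_def)
    hence c: "c ^ q = 1" unfolding c_def by (metis power_mult mult.commute)
    hence "c \<noteq> 0" using assms(1) by (auto simp: power_0_left)
    hence unrotate: "image_mset (\<lambda>w. w / c ^ s) (rotated_fibre l s c Z) = fibre l c Z" for Z
      by (simp add: rotated_fibre_def multiset.map_comp o_def)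
    have "fibre l c X \<subseteq># fibre l c Y"
      using image_mset_subseteq_mono[OF sub[OF c], of "\<lambda>w. w / c ^ s"] by (simp only: unrotate)
    hence "count (fibre l c X) z \<le> count (fibre l c Y) z" by (rule mset_subset_eq_count)
    thus ?thesis by (simp add: fibre_def c_def)
  qed (simp add: not_in_iff)
qed

section \<open>Vanishing sums of roots of unity\<close>

text \<open>All elements equal 1, so the sum is the size. This settles m = 1 in both inductions and
  excludes l = 1 once a containment fails.\<close>

lemma unity_mset_1_eqI:
  assumes "unity_mset 1 X" "unity_mset 1 Y" "sum_mset X = sum_mset Y"
  shows "X = Y"
proof -
  have eq: "Z = replicate_mset (size Z) 1" if "unity_mset 1 Z" for Z
    using that by (simp add: unity_mset_def set_mset_subset_singletonD subset_iff)
  have "sum_mset Z = of_nat (size Z)" if "unity_mset 1 Z" for Z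
    by (subst eq[OF that]) simp
  hence "size X = size Y" using assms by simp
  thus ?thesis using eq assms by metis
qed

text \<open>Induction over the primes of \<open>m\<close>. As \<open>size X < p1 \<le> q\<close>, some fibre of \<open>X\<close> is empty; over such a \<open>c\<close>
  the fibre of \<open>Y\<close> represents the common difference \<open>K\<close> of the fibre sums. Adding the smallest
  one, of size \<open>u\<close>, to any fibre of \<open>X\<close> yields the sum of the fibre of \<open>Y\<close>, to which the induction
  hypothesis applies.\<close>

lemma unity_mset_subset_or_large:
  fixes p1 p2 :: nat
  assumes "1 \<le> p2" "p1 \<le> p2" "squarefree m"
    and "\<And>q. prime q \<Longrightarrow> q dvd m \<Longrightarrow> q = p1 \<or> p2 \<le> q"
    and "unity_mset m X" "unity_mset m Y" "sum_mset X = sum_mset Y"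
  shows "X \<subseteq># Y \<or> (int p1 - int (size X)) * (int p2 - 1) \<le> int (size Y)"
  using assms(3-)
proof (induction m arbitrary: X Y rule: less_induct)
  case (less m)
  consider "m = 1" | "size X \<ge> p1" | "m \<noteq> 1" "size X < p1" by linarith
  thus ?case
  proof cases
    case 1
    thus ?thesis using less.prems unity_mset_1_eqI by blast
  next
    case 2
    hence "(int p1 - int (size X)) * (int p2 - 1) \<le> 0"
      using assms(1) by (intro mult_nonpos_nonneg) auto
    thus ?thesis by linarith
  next
    case 3
    have m0: "m \<noteq> 0" using less.prems(1) by (cases "m = 0") simp_all
    \<comment> \<open>A prime factor of at least \<open>p2\<close> is preferred. If \<open>q\<close>
      is below \<open>p2\<close> nevertheless, then \<open>p1\<close> is the only prime factor, and
      squarefreeness gives l = 1.\<close>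
    obtain q where q: "prime q" "q dvd m" and q2: "(\<exists>r. prime r \<and> r dvd m \<and> p2 \<le> r) \<Longrightarrow> p2 \<le> q"
      using 3(1) prime_factor_nat by blast
    obtain l where m: "m = q * l" using q(2) by blast
    have ql: "\<not> q dvd l"
    proof
      assume "q dvd l"
      hence "q ^ 2 dvd m" by (simp add: m power2_eq_square)
      hence "q dvd 1" using less.prems(1) by (simp add: squarefree_def)
      thus False using q(1) by simp
    qed
    have lm: "l < m" "l > 0" using m m0 prime_gt_1_nat[OF q(1)] by auto
    have sql: "squarefree l" using less.prems(1) m squarefree_mono by (metis dvd_triv_right)
    have q0: "q > 0" using prime_gt_0_nat[OF q(1)] .
    have q12: "p1 \<le> q" using less.prems(2)[OF q] assms(2) by auto
    have q2': "p2 \<le> q" if "l \<noteq> 1"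
    proof (rule ccontr)
      assume nq: "\<not> p2 \<le> q"
      obtain r where r: "prime r" "r dvd l" using \<open>l \<noteq> 1\<close> prime_factor_nat by blast
      hence "r dvd m" by (simp add: m)
      hence "r = p1" using less.prems(2)[of r] r q2 nq by blast
      moreover have "q = p1" using less.prems(2)[OF q] nq by blast
      ultimately show False using r ql by simp
    qed
    obtain s where s: "s < q" "q dvd 1 + l * s" using rotation_exponent_exists[OF q(1) ql] by blast
    define \<Phi> where "\<Phi> = rotated_fibre l s"
    note \<Phi> = unity_mset_rotated_fibre[OF s(2), folded \<Phi>_def]
      size_rotated_fibres[where s = s and l = l, OF q0, folded \<Phi>_def]
      subset_mset_rotated_fibres[where s = s and l = l, OF q0, folded \<Phi>_def]
      rotated_fibre_sums_const[OF q(1) ql s(2,1), folded \<Phi>_def]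
    note X = less.prems(3)[unfolded m] and Y = less.prems(4)[unfolded m]
    obtain K where K: "\<And>c. c ^ q = 1 \<Longrightarrow> sum_mset (\<Phi> c Y) = sum_mset (\<Phi> c X) + K"
      using \<Phi>(4)[OF X Y less.prems(5)] by blast
    define U where "U = {c :: complex. c ^ q = 1}"
    have fin: "finite U" unfolding U_def using q0 by (intro finite_roots_unity) simp
    have cardU: "card U = q" unfolding U_def using q0 by (rule card_roots_unity_eq)
    define J where "J = {c \<in> U. \<Phi> c X = {#}}"
    have J: "J \<subseteq> U" "finite J" using fin by (auto simp: J_def)
    define b where "b = size X"
    define bc where "bc c = size (\<Phi> c X)" for c
    define ac where "ac c = size (\<Phi> c Y)" for c
    have b: "b = (\<Sum>c\<in>U. bc c)" using \<Phi>(2)[OF X] by (simp add: b_def bc_def U_def)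
    have a: "size Y = (\<Sum>c\<in>U. ac c)" using \<Phi>(2)[OF Y] by (simp add: ac_def U_def)
    have card_le: "card (V - J) \<le> (\<Sum>c\<in>V. bc c)" if "V \<subseteq> U" for V
    proof -
      have fV: "finite V" using that fin finite_subset by blast
      have "card (V - J) = (\<Sum>c\<in>V - J. 1)" by simp
      also have "\<dots> \<le> (\<Sum>c\<in>V - J. bc c)"
      proof (rule sum_mono)
        fix c assume "c \<in> V - J"
        hence "\<Phi> c X \<noteq> {#}" using that by (auto simp: J_def)
        thus "1 \<le> bc c" by (simp add: bc_def Suc_le_eq nonempty_has_size)
      qed
      also have "\<dots> \<le> (\<Sum>c\<in>V. bc c)" using fV by (intro sum_mono2) auto
      finally show ?thesis .
    qed
    have "card (U - J) = q - card J" using J cardU by (simp add: card_Diff_subset)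
    hence cardJ: "q \<le> card J + b" using card_le[of U] b by simp
    hence "J \<noteq> {}" using 3(2) q12 b_def by auto
    then obtain i where i: "i \<in> J" and imin: "\<And>c. c \<in> J \<Longrightarrow> ac i \<le> ac c"
      using ex_has_least_nat[of "\<lambda>c. c \<in> J" _ ac] by (metis ex_in_conv)
    define u where "u = ac i"
    have "sum_mset (\<Phi> i Y) = K" using K[of i] i by (simp add: J_def U_def)
    hence sums: "sum_mset (\<Phi> c X + \<Phi> i Y) = sum_mset (\<Phi> c Y)" if "c \<in> U" for c
      using K[of c] that by (simp add: U_def)
    have unity: "unity_mset l (\<Phi> c X + \<Phi> i Y)" "unity_mset l (\<Phi> c Y)" if "c \<in> U" for c
      using \<Phi>(1)[of c] \<Phi>(1)[of i] that i by (auto simp: unity_mset_def U_def J_def)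
    have alt: "\<Phi> c X + \<Phi> i Y \<subseteq># \<Phi> c Y \<or> (int p1 - int (bc c + u)) * (int p2 - 1) \<le> int (ac c)"
      if "c \<in> U" for c
      using less.IH[OF lm(1) sql _ unity[OF that] sums[OF that]] less.prems(2)
      by (simp add: m bc_def ac_def u_def)
    show ?thesis
    proof (cases "\<forall>c\<in>U. \<Phi> c X + \<Phi> i Y \<subseteq># \<Phi> c Y")
      case True
      hence "\<forall>c. c ^ q = 1 \<longrightarrow> \<Phi> c X \<subseteq># \<Phi> c Y"
        unfolding U_def by (meson mem_Collect_eq mset_subset_eq_add_left subset_mset.order_trans)
      thus ?thesis using \<Phi>(3)[OF X, of Y] by blast
    next
      case False
      then obtain c where c: "c \<in> U" "\<not> \<Phi> c X + \<Phi> i Y \<subseteq># \<Phi> c Y" by blast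
      hence ac: "(int p1 - int (bc c + u)) * (int p2 - 1) \<le> int (ac c)" using alt by blast
      have "l \<noteq> 1"
      proof
        assume l: "l = 1"
        have "\<Phi> c X + \<Phi> i Y = \<Phi> c Y"
          using unity[OF c(1)] sums[OF c(1)] l by (intro unity_mset_1_eqI) auto
        thus False using c(2) by simp
      qed
      hence p2q: "p2 \<le> q" by (rule q2')
      have sumJ: "card V * u \<le> (\<Sum>c\<in>V. ac c)" if "V \<subseteq> J" for V
        using sum_mono[of V "\<lambda>_. u" ac] imin that by (auto simp: u_def)
      \<comment> \<open>\<open>t\<close> counts the elements of \<open>X\<close> outside the fibre
        over \<open>c\<close>. At least q - 1 - t of the other fibres are thus empty, and over each
        of these \<open>Y\<close> has at least \<open>u\<close> elements.\<close>
      define t where "t = b - bc c"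
      have split_b: "b = bc c + (\<Sum>c\<in>U - {c}. bc c)" using b fin c(1) by (simp add: sum.remove)
      hence bt: "b = bc c + t" by (simp add: t_def)
      have "card (U - {c} - J) \<le> t" using card_le[of "U - {c}"] split_b by (simp add: t_def)
      moreover have "card (U - {c}) = q - 1" using c(1) cardU fin by simp
      moreover have "card (U - {c}) \<le> card (U - {c} - J) + card (J - {c})"
      proof -
        have "U - {c} = (U - {c} - J) \<union> (J - {c})" using J by blast
        thus ?thesis by (metis card_Un_le)
      qed
      ultimately have cardJc: "q \<le> card (J - {c}) + 1 + t" by linarith
      show ?thesis
      proof (cases "u < p2")
        case True
        \<comment> \<open>The fibre of \<open>Y\<close> over \<open>c\<close> is combined with the
          other fibres over \<open>J\<close>. The resulting lower bound exceeds the target by t *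
          (p2 - 1 - u) + u * (q - p2), which is nonnegative here.\<close>
        have "ac c + card (J - {c}) * u \<le> ac c + (\<Sum>c\<in>J - {c}. ac c)" using sumJ[of "J - {c}"] by auto
        also have "\<dots> \<le> ac c + (\<Sum>c\<in>U - {c}. ac c)" using J fin by (intro add_left_mono sum_mono2) auto
        also have "\<dots> = size Y" using a fin c(1) by (simp add: sum.remove)
        finally have 1: "int (ac c) + int (card (J - {c})) * int u \<le> int (size Y)"
          by (metis of_nat_add of_nat_le_iff of_nat_mult)
        have "(int q - 1 - int t) * int u \<le> int (card (J - {c})) * int u"
          using cardJc by (intro mult_right_mono) auto
        moreover have "0 \<le> int t * (int p2 - 1 - int u)" "0 \<le> int u * (int q - int p2)"
          using True p2q by auto
        ultimately have "(int p1 - int b) * (int p2 - 1) \<le> int (size Y)"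
          using 1 ac unfolding bt by (simp add: algebra_simps)
        thus ?thesis by (simp add: b_def)
      next
        case False
        \<comment> \<open>For u at least \<open>p2\<close> the fibres over \<open>J\<close> suffice
          on their own: there are at least q - b, hence p1 - b, of them.\<close>
        have "(int p1 - int b) * (int p2 - 1) \<le> int (card J) * int u"
          using cardJ q12 False 3(2) assms(1) by (intro mult_mono) (auto simp: b_def)
        also have "\<dots> \<le> int (\<Sum>c\<in>J. ac c)" using sumJ[of J] by (metis of_nat_le_iff of_nat_mult order_refl)
        also have "(\<Sum>c\<in>J. ac c) \<le> size Y" unfolding a using J fin by (intro sum_mono2) auto
        finally show ?thesis by (simp add: b_def)
      qed
    qed
  qed
qed

section \<open>Combinations of prime divisors and the theorem of Lam and Leung\<close>

definition prime_span :: "nat \<Rightarrow> nat set" where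
  "prime_span m = {n. \<exists>c. n = (\<Sum>p\<in>prime_factors m. c p * p)}"

lemma zero_in_prime_span: "0 \<in> prime_span m"
  unfolding prime_span_def by (auto intro!: exI[of _ "\<lambda>_. 0"])

lemma add_in_prime_span: "a \<in> prime_span m \<Longrightarrow> b \<in> prime_span m \<Longrightarrow> a + b \<in> prime_span m"
  unfolding prime_span_def
  by (clarsimp, rule_tac x = "\<lambda>p. c p + ca p" in exI) (simp add: sum.distrib algebra_simps)

lemma sum_in_prime_span:
  "(\<And>x. x \<in> A \<Longrightarrow> f x \<in> prime_span m) \<Longrightarrow> (\<Sum>x\<in>A. f x) \<in> prime_span m"
  by (induction A rule: infinite_finite_induct) (auto simp: zero_in_prime_span add_in_prime_span)

lemma multiple_in_prime_span:
  assumes "p \<in> prime_factors m"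
  shows "k * p \<in> prime_span m"
proof -
  have "k * p = (\<Sum>q\<in>prime_factors m. if q = p then k * p else 0)" using assms by simp
  also have "\<dots> = (\<Sum>q\<in>prime_factors m. (if q = p then k else 0) * q)" by (intro sum.cong) auto
  finally show ?thesis
    unfolding prime_span_def mem_Collect_eq by (rule exI[of _ "\<lambda>q. if q = p then k else 0"])
qed

lemma prime_span_mono:
  assumes "l dvd m" "m \<noteq> 0"
  shows "prime_span l \<subseteq> prime_span m"
proof
  fix n assume "n \<in> prime_span l"
  then obtain c where "n = (\<Sum>p\<in>prime_factors l. c p * p)" by (auto simp: prime_span_def)
  moreover have "prime_factors l \<subseteq> prime_factors m" using assms by (rule dvd_prime_factors[rotated])
  ultimately show "n \<in> prime_span m"
    using sum_in_prime_span multiple_in_prime_span by (metis (no_types, lifting) subsetD)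
qed

text \<open>The residue \<open>j\<close> of n / q modulo \<open>p\<close> satisfies q * j <= q * (p
  - 1) <= p * (q - 1) <= n, so n - q * j is a nonnegative multiple of \<open>p\<close>.\<close>

lemma frobenius_coin:
  fixes p q n :: nat
  assumes "coprime p q" "0 < p" "p \<le> q" "p * (q - 1) \<le> n"
  shows "\<exists>i j. n = i * p + j * q"
proof -
  obtain x where "[q * x = 1] (mod p)"
    using assms(1) cong_solve_coprime_nat[of q p] by (auto simp: coprime_commute)
  hence "[q * x * n = 1 * n] (mod p)" by (intro cong_mult cong_refl)
  hence "[q * ((x * n) mod p) = n] (mod p)" by (simp add: cong_def mod_mult_right_eq mult.assoc)
  moreover define j where "j = (x * n) mod p"
  ultimately have j: "[n = q * j] (mod p)" by (simp add: cong_sym)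
  have "j \<le> p - 1" using assms(2) by (simp add: j_def Suc_le_eq flip: less_Suc_eq_le)
  hence "q * j \<le> q * (p - 1)" by simp
  also have "\<dots> \<le> p * (q - 1)" using assms(3) by (simp add: diff_mult_distrib2 mult.commute)
  finally have le: "q * j \<le> n" using assms(4) by simp
  hence "p dvd n - q * j" using j by (simp add: cong_altdef_nat)
  then obtain i where "n - q * j = p * i" by blast
  hence "n = i * p + j * q" using le by (simp add: mult.commute)
  thus ?thesis by blast
qed

theorem lam_leung:
  assumes "m > 0" "unity_mset m X" "sum_mset X = 0"
  shows "size X \<in> prime_span m"
  using assms
proof (induction m arbitrary: X rule: less_induct)
  case (less m)
  consider "m = 1" | "\<not> squarefree m" | "m \<noteq> 1" "squarefree m" by blast
  thus ?case
  proof cases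
    case 1
    hence "X = {#}" using less.prems by (intro unity_mset_1_eqI) (auto simp: unity_mset_def)
    thus ?thesis by (simp add: zero_in_prime_span)
  next
    case 2
    then obtain d where d: "d ^ 2 dvd m" "\<not> d dvd 1" unfolding squarefree_def by blast
    then obtain q where q: "prime q" "q dvd d" using prime_factor_nat by auto
    hence "q ^ 2 dvd m" using d(1) by (meson dvd_power_same dvd_trans)
    then obtain l' where l': "m = q ^ 2 * l'" by blast
    define l where "l = q * l'"
    have m: "m = q * l" and ql: "q dvd l" by (simp_all add: l' l_def power2_eq_square)
    have l: "l > 0" "l < m" using less.prems(1) m prime_gt_1_nat[OF q(1)] by auto
    have "size (fibre l c X) \<in> prime_span m" if c: "c ^ q = 1" for c
    proof (cases "fibre l c X = {#}")
      case False
      then obtain w where w: "w \<in># fibre l c X" by blast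
      have c0: "c \<noteq> 0" using c prime_gt_0_nat[OF q(1)] by (auto simp: power_0_left)
      \<comment> \<open>Elements of a fibre share their l-th power, so division by one of them
        yields l-th roots of unity. The fibre sum is zero by comparison with the empty
        multiset.\<close>
      let ?Z = "{#z / w. z \<in># fibre l c X#}"
      have "sum_mset (fibre l c X) = sum_mset (fibre l c {#})"
        using less.prems m by (intro fibre_sums_eq[OF q(1) ql l(1) _ _ _ c]) (auto simp: unity_mset_def)
      hence "sum_mset (fibre l c X) = 0" by (simp add: fibre_def)
      moreover have "sum_mset ?Z = sum_mset (fibre l c X) * (1 / w)"
        using sum_mset_distrib_right[of "\<lambda>z. z" "fibre l c X" "1 / w"] by simp
      moreover have "unity_mset l ?Z" using w c0 by (auto simp: unity_mset_def fibre_def power_divide)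
      ultimately have "size ?Z \<in> prime_span l" using l by (intro less.IH) auto
      thus ?thesis using prime_span_mono[of l m] m less.prems(1) by auto
    qed (simp add: zero_in_prime_span)
    thus ?thesis using size_fibres[of q l X] less.prems m prime_gt_0_nat[OF q(1)]
      by (auto intro: sum_in_prime_span)
  next
    case 3
    define p1 where "p1 = Min (prime_factors m)"
    \<comment> \<open>The second smallest prime, or \<open>p1\<close> if there is no other. Every
      prime factor of \<open>m\<close> besides \<open>p1\<close> is then at least \<open>q\<close>,
      which lets \<open>q\<close> serve as \<open>p2\<close> below.\<close>
    define q where "q = (if prime_factors m = {p1} then p1 else Min (prime_factors m - {p1}))"
    have "prime_factors m \<noteq> {}" using 3(1) less.prems(1) by (simp add: prime_factorization_empty_iff)
    hence p1: "p1 \<in> prime_factors m" unfolding p1_def by (intro Min_in) auto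
    have q_min: "q \<in> prime_factors m \<and> (\<forall>r\<in>prime_factors m. r = p1 \<or> q \<le> r)
       \<and> (prime_factors m = {p1} \<or> q \<noteq> p1)"
    proof (cases "prime_factors m = {p1}")
      case False
      hence "Min (prime_factors m - {p1}) \<in> prime_factors m - {p1}"
        using p1 by (intro Min_in) auto
      thus ?thesis using False by (auto simp: q_def)
    qed (simp add: q_def)
    have p1q: "p1 \<le> q" using q_min unfolding p1_def by (intro Min_le) auto
    have q: "prime q" "q dvd m" and prime_p1: "prime p1" using q_min p1 by auto
    obtain l where m: "m = q * l" using q(2) by blast
    have ql: "\<not> q dvd l"
    proof
      assume "q dvd l"
      hence "q ^ 2 dvd m" by (simp add: m power2_eq_square)
      hence "q dvd 1" using 3(2) by (simp add: squarefree_def)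
      thus False using q(1) by simp
    qed
    have l: "l < m" "l > 0" using m less.prems(1) prime_gt_1_nat[OF q(1)] by auto
    have sql: "squarefree l" using 3(2) m squarefree_mono by (metis dvd_triv_right)
    have q0: "q > 0" using prime_gt_0_nat[OF q(1)] .
    obtain s where s: "s < q" "q dvd 1 + l * s" using rotation_exponent_exists[OF q(1) ql] by blast
    define \<Phi> where "\<Phi> = rotated_fibre l s"
    note \<Phi> = unity_mset_rotated_fibre[OF s(2), folded \<Phi>_def]
      size_rotated_fibres[where s = s and l = l, OF q0, folded \<Phi>_def]
      subset_mset_rotated_fibres[where s = s and l = l, OF q0, folded \<Phi>_def]
      rotated_fibre_sums_const[OF q(1) ql s(2,1), folded \<Phi>_def]
    note X = less.prems(2)[unfolded m]
    \<comment> \<open>Comparison with the empty multiset, whose rotated fibres have sum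
      zero.\<close>
    obtain K where K: "\<And>c. c ^ q = 1 \<Longrightarrow> sum_mset (\<Phi> c X) = K"
      using \<Phi>(4)[of "{#}" X] X less.prems(3) by (auto simp: \<Phi>_def unity_mset_def)
    define U where "U = {c :: complex. c ^ q = 1}"
    have fin: "finite U" unfolding U_def using q0 by (intro finite_roots_unity) simp
    have cardU: "card U = q" unfolding U_def using q0 by (rule card_roots_unity_eq)
    have n: "size X = (\<Sum>c\<in>U. size (\<Phi> c X))" using \<Phi>(2)[OF X] by (simp add: U_def)
    have "U \<noteq> {}" using cardU q0 by auto
    then obtain i where i: "i \<in> U" and imin: "\<And>c. c \<in> U \<Longrightarrow> size (\<Phi> i X) \<le> size (\<Phi> c X)"
      using ex_has_least_nat[of "\<lambda>c. c \<in> U" _ "\<lambda>c. size (\<Phi> c X)"] by (metis ex_in_conv)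
    define b where "b = size (\<Phi> i X)"
    show ?thesis
    proof (cases "\<forall>c\<in>U. \<Phi> i X \<subseteq># \<Phi> c X")
      case True
      \<comment> \<open>Removing the smallest fibre from another one leaves a vanishing sum of l-th
        roots of unity. The removed parts account for b * q terms.\<close>
      have "size (\<Phi> c X) - b \<in> prime_span m" if c: "c \<in> U" for c
      proof -
        have sub: "\<Phi> i X \<subseteq># \<Phi> c X" using True c by blast
        have "sum_mset (\<Phi> i X) + sum_mset (\<Phi> c X - \<Phi> i X) = sum_mset (\<Phi> c X)"
          using sub by (metis subset_mset.add_diff_inverse sum_mset.union)
        hence "sum_mset (\<Phi> c X - \<Phi> i X) = 0" using K i c by (simp add: U_def)
        moreover have "unity_mset l (\<Phi> c X - \<Phi> i X)"
          using \<Phi>(1)[of c X] c by (auto simp: U_def unity_mset_def dest: in_diffD)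
        ultimately have "size (\<Phi> c X - \<Phi> i X) \<in> prime_span l" using l by (intro less.IH) auto
        thus ?thesis using sub prime_span_mono[of l m] m less.prems(1)
          by (auto simp: size_Diff_submset b_def)
      qed
      hence "(\<Sum>c\<in>U. size (\<Phi> c X) - b) \<in> prime_span m" by (rule sum_in_prime_span)
      moreover have "size X = b * q + (\<Sum>c\<in>U. size (\<Phi> c X) - b)"
      proof -
        have "(\<Sum>c\<in>U. size (\<Phi> c X)) = (\<Sum>c\<in>U. b + (size (\<Phi> c X) - b))"
          using imin by (intro sum.cong) (auto simp: b_def)
        thus ?thesis by (simp add: n sum.distrib cardU mult.commute)
      qed
      ultimately show ?thesis using q_min by (simp add: add_in_prime_span multiple_in_prime_span)
    next
      case False
      then obtain c where c: "c \<in> U" "\<not> \<Phi> i X \<subseteq># \<Phi> c X" by blast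
      have "l \<noteq> 1"
      proof
        assume "l = 1"
        hence "\<Phi> i X = \<Phi> c X"
          using \<Phi>(1)[of c X] \<Phi>(1)[of i X] K c(1) i by (intro unity_mset_1_eqI) (auto simp: U_def)
        thus False using c(2) by simp
      qed
      have "q \<noteq> p1"
      proof
        assume "q = p1"
        hence pf: "prime_factors m = {q}" using q_min by auto
        obtain r where r: "prime r" "r dvd l" using \<open>l \<noteq> 1\<close> prime_factor_nat by blast
        hence "r \<in> prime_factors m" using m less.prems(1) by (simp add: in_prime_factors_iff)
        thus False using pf r ql by simp
      qed
      have "(int p1 - int b) * (int q - 1) \<le> int (size (\<Phi> c X))"
      proof -
        have "\<Phi> i X \<subseteq># \<Phi> c X \<or> (int p1 - int (size (\<Phi> i X))) * (int q - 1) \<le> int (size (\<Phi> c X))"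
        proof (rule unity_mset_subset_or_large[OF _ p1q sql])
          show "r = p1 \<or> q \<le> r" if "prime r" "r dvd l" for r
            using that q_min m less.prems(1) by (auto simp: in_prime_factors_iff)
        qed (use \<Phi>(1) K c(1) i q0 in \<open>auto simp: U_def\<close>)
        thus ?thesis using c(2) by (simp add: b_def)
      qed
      moreover have int_q: "int (q - 1) = int q - 1" using q0 by (simp add: of_nat_diff)
      \<comment> \<open>The other q - 1 fibres have at least \<open>b\<close> elements each; added
        to (p1 - b) * (q - 1), this makes \<open>b\<close> cancel.\<close>
      have "size (\<Phi> c X) + (q - 1) * b \<le> size X"
      proof -
        have "(\<Sum>c\<in>U - {c}. b) \<le> (\<Sum>c\<in>U - {c}. size (\<Phi> c X))"
          using imin by (intro sum_mono) (auto simp: b_def)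
        moreover have "(\<Sum>c\<in>U - {c}. b) = (q - 1) * b" using fin c(1) cardU by simp
        moreover have "size X = size (\<Phi> c X) + (\<Sum>c\<in>U - {c}. size (\<Phi> c X))"
          unfolding n by (rule sum.remove[OF fin c(1)])
        ultimately show ?thesis by linarith
      qed
      hence "int (size (\<Phi> c X) + (q - 1) * b) \<le> int (size X)" by (simp only: of_nat_le_iff)
      hence "int (size (\<Phi> c X)) + (int q - 1) * int b \<le> int (size X)"
        by (simp only: of_nat_add of_nat_mult int_q)
      ultimately have "int p1 * (int q - 1) \<le> int (size X)" by (simp add: algebra_simps)
      hence "int (p1 * (q - 1)) \<le> int (size X)" by (simp only: of_nat_mult int_q)
      hence "p1 * (q - 1) \<le> size X" by (simp only: of_nat_le_iff)
      moreover have "coprime p1 q" using primes_coprime[OF prime_p1 q(1)] \<open>q \<noteq> p1\<close> by simp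
      ultimately obtain x y where "size X = x * p1 + y * q"
        using frobenius_coin[OF _ _ p1q] prime_gt_0_nat[OF prime_p1] by blast
      thus ?thesis using p1 q_min by (simp add: add_in_prime_span multiple_in_prime_span)
    qed
  qed
qed

text \<open>For a prime \<open>p\<close> dividing \<open>k\<close>, the \<open>p\<close> distinct
  p-th roots of unity have sum zero; unions of such multisets realise every combination.\<close>

lemma prime_span_unity_mset:
  assumes "n \<in> prime_span k"
  shows "\<exists>X. unity_mset k X \<and> sum_mset X = 0 \<and> size X = n"
proof -
  let ?P = "\<lambda>n. \<exists>X. unity_mset k X \<and> sum_mset X = 0 \<and> size X = n"
  have zero: "?P 0" by (intro exI[of _ "{#}"]) (simp add: unity_mset_def)
  have add: "?P (a + b)" if a: "?P a" and b: "?P b" for a b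
  proof -
    obtain X where "unity_mset k X \<and> sum_mset X = 0 \<and> size X = a" using a by blast
    moreover obtain Y where "unity_mset k Y \<and> sum_mset Y = 0 \<and> size Y = b" using b by blast
    ultimately show ?thesis by (intro exI[of _ "X + Y"]) (auto simp: unity_mset_def)
  qed
  have prime: "?P p" if "p \<in> prime_factors k" for p
  proof -
    have p: "p > 1" using that by (intro prime_gt_1_nat) (simp add: in_prime_factors_iff)
    have "p dvd k" using that by (simp add: in_prime_factors_iff)
    then obtain j where j: "k = p * j" by blast
    have fin: "finite {z :: complex. z ^ p = 1}" using p by (intro finite_roots_unity) simp
    let ?X = "mset_set {z :: complex. z ^ p = 1}"
    have "unity_mset k ?X" using fin by (simp add: unity_mset_def j power_mult)
    moreover have "sum_mset ?X = 0" using sum_roots_unity[OF p] by (simp add: sum_unfold_sum_mset)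
    moreover have "size ?X = p" using card_roots_unity_eq[of p] p by simp
    ultimately show ?thesis by blast
  qed
  have mult: "?P (c * p)" if "p \<in> prime_factors k" for c p
    by (induction c) (use zero add prime[OF that] in \<open>auto simp del: One_nat_def\<close>)
  obtain c where n: "n = (\<Sum>p\<in>prime_factors k. c p * p)" using assms by (auto simp: prime_span_def)
  have "?P (\<Sum>p\<in>A. c p * p)" if "A \<subseteq> prime_factors k" "finite A" for A
    using that(2,1) by (induction A rule: finite_induct) (use zero add mult in auto)
  thus ?thesis using n by blast
qed

section \<open>Trace zero matrices and commutators\<close>

lemma sum_diag_mult_commute:
  fixes A B :: "'a :: comm_semiring_0 mat"
  assumes "A \<in> carrier_mat n n" "B \<in> carrier_mat n n"
  shows "(\<Sum>i<n. (A * B) $$ (i, i)) = (\<Sum>i<n. (B * A) $$ (i, i))"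
proof -
  have "(\<Sum>i<n. (A * B) $$ (i, i)) = (\<Sum>i<n. \<Sum>j<n. A $$ (i, j) * B $$ (j, i))"
    using assms by (intro sum.cong) (auto simp: scalar_prod_def lessThan_atLeast0)
  also have "\<dots> = (\<Sum>j<n. \<Sum>i<n. B $$ (j, i) * A $$ (i, j))"
    by (subst sum.swap) (simp add: mult.commute)
  also have "\<dots> = (\<Sum>j<n. (B * A) $$ (j, j))"
    using assms by (intro sum.cong) (auto simp: scalar_prod_def lessThan_atLeast0)
  finally show ?thesis .
qed

lemma eigenvalue_unity:
  fixes C :: "'a :: field mat"
  assumes C: "C \<in> carrier_mat n n" and "C ^\<^sub>m k = 1\<^sub>m n" and "eigenvalue C e"
  shows "e ^ k = 1"
proof -
  obtain v where v: "eigenvector C v e" using assms(3) by (auto simp: eigenvalue_def)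
  hence vn: "v \<in> carrier_vec n" "v \<noteq> 0\<^sub>v n" using C by (auto simp: eigenvector_def)
  have "v = e ^ k \<cdot>\<^sub>v v" using eigenvector_pow[OF C v, of k] assms(2) vn(1) by simp
  hence eq: "v $ i = e ^ k * v $ i" if "i < n" for i
    using that vn(1) by (metis carrier_vecD index_smult_vec(1))
  obtain i where "i < n" "v $ i \<noteq> 0" using vn by (metis eq_vecI carrier_vecD index_zero_vec)
  thus ?thesis using eq[of i] by simp
qed

text \<open>The witness is the multiset of eigenvalues with algebraic multiplicity. Schur
  decomposition puts them on the diagonal of a matrix similar to \<open>C\<close>, and similarity
  preserves the trace.\<close>

lemma trace_zero_unity_mset:
  fixes C :: "complex mat"
  assumes C: "C \<in> carrier_mat n n" and pow: "C ^\<^sub>m k = 1\<^sub>m n" and tr: "(\<Sum>i<n. C $$ (i, i)) = 0"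
  shows "\<exists>X. unity_mset k X \<and> sum_mset X = 0 \<and> size X = n"
proof -
  obtain es where es: "char_poly C = (\<Prod>a\<leftarrow>es. [:- a, 1:])" "length es = n"
    using char_poly_factorized[OF C] by blast
  obtain B P Q where BPQ: "schur_decomposition C es = (B, P, Q)" by (metis prod_cases3)
  have sim: "similar_mat_wit C B P Q" and diag: "diag_mat B = es"
    using schur_decomposition[OF C es(1) BPQ] by auto
  note D = similar_mat_witD2[OF C sim]
  have "(\<Sum>i<n. B $$ (i, i)) = (\<Sum>i<n. ((B * Q) * P) $$ (i, i))"
    using D by (simp add: assoc_mult_mat[of B n n Q n P n])
  also have "\<dots> = (\<Sum>i<n. (P * (B * Q)) $$ (i, i))"
    using D by (intro sum_diag_mult_commute) auto
  also have "P * (B * Q) = C" using D by (simp add: assoc_mult_mat[of P n n B n Q n])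
  finally have "(\<Sum>i<n. B $$ (i, i)) = 0" using tr by simp
  hence "sum_list es = 0" using D unfolding diag[symmetric] diag_mat_def
    by (simp add: sum_list_sum_nth lessThan_atLeast0)
  moreover have "e ^ k = 1" if "e \<in> set es" for e
  proof (rule eigenvalue_unity[OF C pow])
    show "eigenvalue C e"
      unfolding eigenvalue_root_char_poly[OF C] es(1) using that
      by (auto simp: poly_prod_list prod_list_zero_iff)
  qed
  ultimately show ?thesis using es(2)
    by (intro exI[of _ "mset es"]) (auto simp: unity_mset_def sum_mset_sum_list)
qed

definition diagonal :: "nat \<Rightarrow> (nat \<Rightarrow> 'a :: semiring_1) \<Rightarrow> 'a mat" where
  "diagonal n d = mat n n (\<lambda>(i, j). if i = j then d i else 0)"

lemma diagonal_pow: "diagonal n d ^\<^sub>m k = diagonal n (\<lambda>i. d i ^ k)"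
proof (induction k)
  case 0
  show ?case by (auto simp: diagonal_def intro!: eq_matI)
next
  case (Suc k)
  have "diagonal n (\<lambda>i. d i ^ k) * diagonal n d = diagonal n (\<lambda>i. d i ^ Suc k)"
  proof (rule eq_matI)
    fix i j assume ij: "i < dim_row (diagonal n (\<lambda>i. d i ^ Suc k))" "j < dim_col (diagonal n (\<lambda>i. d i ^ Suc k))"
    hence "(diagonal n (\<lambda>i. d i ^ k) * diagonal n d) $$ (i, j) =
        (\<Sum>t\<in>{0..<n}. (if i = t then d i ^ k else 0) * (if t = j then d t else 0))"
      by (simp add: diagonal_def scalar_prod_def)
    also have "\<dots> = (\<Sum>t\<in>{0..<n}. if t = i then (if i = j then d i ^ k * d i else 0) else 0)"
      by (intro sum.cong) auto
    also have "\<dots> = (if i = j then d i ^ k * d i else 0)" using ij by (simp add: diagonal_def)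
    also have "\<dots> = diagonal n (\<lambda>i. d i ^ Suc k) $$ (i, j)"
      using ij by (simp add: diagonal_def power_commutes)
    finally show "(diagonal n (\<lambda>i. d i ^ k) * diagonal n d) $$ (i, j) =
      diagonal n (\<lambda>i. d i ^ Suc k) $$ (i, j)" .
  qed (simp_all add: diagonal_def)
  thus ?case by (simp add: Suc.IH)
qed

text \<open>The two products are diagonal with entries s (i + 1) and s i, whose difference is d
  i.\<close>

lemma diagonal_is_commutator:
  fixes d :: "nat \<Rightarrow> 'a :: ring_1"
  assumes "(\<Sum>i<n. d i) = 0"
  shows "\<exists>A\<in>carrier_mat n n. \<exists>B\<in>carrier_mat n n. commutator A B = diagonal n d"
proof -
  define s where "s i = (\<Sum>t<i. d t)" for i
  \<comment> \<open>a nilpotent shift and its transpose weighted by the partial sums \<open>s\<close>\<close>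
  define A :: "'a mat" where "A = mat n n (\<lambda>(i, j). if j = Suc i then 1 else 0)"
  define B :: "'a mat" where "B = mat n n (\<lambda>(i, j). if i = Suc j then s i else 0)"
  have AB: "(A * B) $$ (i, j) = (if i = j then s (Suc i) else 0)" if ij: "i < n" "j < n" for i j
  proof -
    have "(A * B) $$ (i, j) = (\<Sum>t\<in>{0..<n}. (if t = Suc i then 1 else 0) * (if t = Suc j then s t else 0))"
      using ij by (simp add: A_def B_def scalar_prod_def)
    also have "\<dots> = (\<Sum>t\<in>{0..<n}. if t = Suc i then (if i = j then s t else 0) else 0)"
      by (intro sum.cong) auto
    also have "\<dots> = (if Suc i < n then (if i = j then s (Suc i) else 0) else 0)" by simp
    \<comment> \<open>The last row of the shift is zero, which agrees with \<open>s n\<close> being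
      the full sum 0; this is where the trace condition enters.\<close>
    also have "\<dots> = (if i = j then s (Suc i) else 0)"
    proof (cases "Suc i < n")
      case False
      hence "Suc i = n" using ij by simp
      thus ?thesis using assms by (auto simp: s_def)
    qed simp
    finally show ?thesis .
  qed
  have BA: "(B * A) $$ (i, j) = (if i = j then s i else 0)" if ij: "i < n" "j < n" for i j
  proof -
    have "(B * A) $$ (i, j) = (\<Sum>t\<in>{0..<n}. (if i = Suc t then s i else 0) * (if j = Suc t then 1 else 0))"
      using ij by (simp add: A_def B_def scalar_prod_def)
    also have "\<dots> = (if i = j then s i else 0)"
    proof (cases i)
      case 0
      thus ?thesis by (simp add: s_def)
    next
      case (Suc t0)
      have "(\<Sum>t\<in>{0..<n}. (if i = Suc t then s i else 0) * (if j = Suc t then 1 else 0)) =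
        (\<Sum>t\<in>{0..<n}. if t = t0 then (if i = j then s i else 0) else 0)"
        using Suc by (intro sum.cong) auto
      thus ?thesis using Suc ij by simp
    qed
    finally show ?thesis .
  qed
  have carrier: "A \<in> carrier_mat n n" "B \<in> carrier_mat n n" by (simp_all add: A_def B_def)
  moreover have "commutator A B = diagonal n d"
    unfolding commutator_def
    by (rule eq_matI) (use carrier AB BA in \<open>auto simp: diagonal_def s_def simp del: index_mult_mat(1)\<close>)
  ultimately show ?thesis by blast
qed

lemma M_set_nonempty_iff:
  "M_set k n \<noteq> {} \<longleftrightarrow> (\<exists>X. unity_mset k X \<and> sum_mset X = 0 \<and> size X = n)"
proof
  assume "M_set k n \<noteq> {}"
  then obtain A B :: "complex mat" where AB: "A \<in> carrier_mat n n" "B \<in> carrier_mat n n" "commutator A B ^\<^sub>m k = 1\<^sub>m n"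
    by (auto simp: M_set_def)
  have "(\<Sum>i<n. commutator A B $$ (i, i)) = (\<Sum>i<n. (A * B) $$ (i, i) - (B * A) $$ (i, i))"
    using AB by (intro sum.cong) (auto simp: commutator_def)
  hence "(\<Sum>i<n. commutator A B $$ (i, i)) = 0"
    using sum_diag_mult_commute[OF AB(1,2)] by (simp add: sum_subtractf)
  moreover have "commutator A B \<in> carrier_mat n n" using AB by (auto simp: commutator_def)
  ultimately show "\<exists>X. unity_mset k X \<and> sum_mset X = 0 \<and> size X = n"
    using AB(3) trace_zero_unity_mset by blast
next
  assume "\<exists>X. unity_mset k X \<and> sum_mset X = 0 \<and> size X = n"
  then obtain X where X: "unity_mset k X" "sum_mset X = 0" "size X = n" by blast
  obtain ds where ds: "mset ds = X" using ex_mset by blast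
  have len: "length ds = n" using ds X(3) by auto
  have "sum_list ds = 0" using ds X(2) by (auto simp: sum_mset_sum_list)
  hence "(\<Sum>i<n. ds ! i) = 0" by (simp add: sum_list_sum_nth len lessThan_atLeast0)
  then obtain A B :: "complex mat" where AB: "A \<in> carrier_mat n n" "B \<in> carrier_mat n n" "commutator A B = diagonal n (\<lambda>i. ds ! i)"
    using diagonal_is_commutator[of "\<lambda>i. ds ! i" n] by blast
  have "ds ! i ^ k = 1" if "i < n" for i
  proof -
    have "ds ! i \<in># X" using that len by (auto simp flip: ds)
    thus ?thesis using X(1) by (simp add: unity_mset_def)
  qed
  hence "commutator A B ^\<^sub>m k = 1\<^sub>m n"
    unfolding AB(3) diagonal_pow by (auto simp: diagonal_def intro!: eq_matI)
  thus "M_set k n \<noteq> {}" using AB(1,2) by (auto simp: M_set_def)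
qed

text \<open>As the exponents are positive and \<open>p\<close> is injective, \<open>p\<close>
  enumerates the prime factors of \<open>k\<close> without repetition; coefficients are transported
  along \<open>p\<close> and its inverse.\<close>

lemma nat_combinations_eq_prime_span:
  assumes "\<forall>i\<in>{1..r}. prime (p i)" "inj_on p {1..r}" "\<forall>i\<in>{1..r}. \<alpha> i \<ge> 1"
    and "k = (\<Prod>i=1..r. p i ^ \<alpha> i)"
  shows "nat_combinations r p = prime_span k"
proof -
  have "0 \<notin> (\<lambda>i. p i ^ \<alpha> i) ` {1..r}" using assms(1) by auto
  hence "prime_factors k = (\<Union>i\<in>{1..r}. prime_factors (p i ^ \<alpha> i))"
    unfolding assms(4) by (subst prime_factors_prod) (simp_all only: finite_atLeastAtMost o_def not_False_eq_True)
  moreover have "prime_factors (p i ^ \<alpha> i) = {p i}" if "i \<in> {1..r}" for i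
  proof -
    have "prime (p i)" "\<alpha> i > 0" using assms(1,3) that by fastforce+
    thus ?thesis by (simp add: prime_factorization_prime_power)
  qed
  ultimately have pf: "prime_factors k = p ` {1..r}" by auto
  have eq: "(\<Sum>q\<in>prime_factors k. c q * q) = (\<Sum>i=1..r. c (p i) * p i)" for c
    using sum.reindex[OF assms(2), of "\<lambda>q. c q * q"] by (simp add: pf o_def)
  show ?thesis
  proof (intro equalityI subsetI)
    fix n assume "n \<in> nat_combinations r p"
    then obtain c where n: "n = (\<Sum>i=1..r. c i * p i)" by (auto simp: nat_combinations_def)
    have "n = (\<Sum>i=1..r. c (inv_into {1..r} p (p i)) * p i)"
      unfolding n using assms(2) by (intro sum.cong) auto
    also have "\<dots> = (\<Sum>q\<in>prime_factors k. c (inv_into {1..r} p q) * q)" by (simp only: eq)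
    finally show "n \<in> prime_span k" unfolding prime_span_def by (auto intro!: exI[of _ "\<lambda>q. c (inv_into {1..r} p q)"])
  next
    fix n assume "n \<in> prime_span k"
    thus "n \<in> nat_combinations r p" unfolding prime_span_def nat_combinations_def eq by auto
  qed
qed

theorem theorem2p5:
  fixes k n r :: nat and p \<alpha> :: "nat \<Rightarrow> nat"
  assumes "k > 1" and "n > 1"
    and "\<forall>i\<in>{1..r}. prime (p i)"
    and "inj_on p {1..r}"
    and "\<forall>i\<in>{1..r}. \<alpha> i \<ge> 1"
    and "k = (\<Prod>i=1..r. p i ^ \<alpha> i)"
  shows "M_set k n \<noteq> {} \<longleftrightarrow> n \<in> nat_combinations r p"
  unfolding M_set_nonempty_iff nat_combinations_eq_prime_span[OF assms(3-6)]
  using lam_leung[of k] prime_span_unity_mset[of n k] assms(1) by auto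

end
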